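(* Let $f_1,\ldots,f_m:\mathbb{R}^d\to\mathbb{R}$ be convex and continuously differentiable and let $\eta>0$, $\rho>0$. Consider AGPDMM (defined in the context) with $K=1$ gradient step per iteration. Then for every iteration $r\geq 1$, $$\boldsymbol{x}_s^{r+1}=\boldsymbol{x}_s^r-\frac{2}{1/\eta+\rho}\,\frac1m\sum_{i=1}^m\nabla f_i(\boldsymbol{x}_s^r).$$ In particular, if $\rho=1/\eta$, then $$\boldsymbol{x}_s^{r+1}=\boldsymbol{x}_s^r-\eta\,\frac1m\sum_{i=1}^m\nabla f_i(\boldsymbol{x}_s^r),$$ i.e. AGPDMM reduces to vanilla gradient descent with stepsize $\eta$ on $\frac1m\sum_{i=1}^m f_i$.
   Context: AGPDMM with $K\ge1$ steps and parameters $\eta,\rho>0$: initialise with $\boldsymbol{x}_s^1\in\mathbb{R}^d$ and $\boldsymbol{\lambda}_{s|i}^1=0$ for $i=1,\ldots,m$. For $r=1,2,\ldots$: each client $i$ sets $\boldsymbol{x}_i^{r,0}=\boldsymbol{x}_s^r$ and for $k=0,\ldots,K-1$ computes $$\boldsymbol{x}_i^{r,k+1}=\boldsymbol{x}_i^{r,k}-\frac{1}{1/\eta+\rho}\big[\nabla f_i(\boldsymbol{x}_i^{r,k})+\rho(\boldsymbol{x}_i^{r,k}-\boldsymbol{x}_s^r)+\boldsymbol{\lambda}_{s|i}^r\big],$$ then sets $\boldsymbol{\lambda}_{i|s}^{r+1}=\rho(\boldsymbol{x}_s^r-\boldsymbol{x}_i^{r,K})-\boldsymbol{\lambda}_{s|i}^r$.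 The server sets $\boldsymbol{x}_s^{r+1}=\frac1m\sum_{i=1}^m(\boldsymbol{x}_i^{r,K}-\boldsymbol{\lambda}_{i|s}^{r+1}/\rho)$ and $\boldsymbol{\lambda}_{s|i}^{r+1}=\rho(\boldsymbol{x}_i^{r,K}-\boldsymbol{x}_s^{r+1})-\boldsymbol{\lambda}_{i|s}^{r+1}$. *)

theory Defs
  imports "HOL-Analysis.Analysis"
begin

text \<open>The gradient is the Riesz representative of the Frechet derivative; the value is
  unspecified where the function is not differentiable.\<close>

definition gradient :: "('a::real_inner \<Rightarrow> real) \<Rightarrow> 'a \<Rightarrow> 'a" where
  "gradient f x = (THE g. GDERIV f x :> g)"

definition continuously_differentiable :: "('a::real_inner \<Rightarrow> real) \<Rightarrow> bool" where
  "continuously_differentiable f \<longleftrightarrow>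
     (\<forall>x. f differentiable (at x)) \<and> continuous_on UNIV (gradient f)"

text \<open>A run of AGPDMM with \<open>K\<close> local steps and clients \<open>1, \<dots>, m\<close>. Rounds \<open>r\<close> start at 1 and
  the initial server point \<open>xs 1\<close> is arbitrary:
  \<open>xs r\<close> is $x_s^r$, \<open>x r i k\<close> is $x_i^{r,k}$,
  \<open>lam_s r i\<close> is the server multiplier $\lambda_{s|i}^r$ and
  \<open>lam_c r i\<close> is the client multiplier $\lambda_{i|s}^r$ (used only for \<open>r \<ge> 2\<close>).\<close>

definition agpdmm ::
  "nat \<Rightarrow> real \<Rightarrow> real \<Rightarrow> nat \<Rightarrow> (nat \<Rightarrow> 'a::real_inner \<Rightarrow> real) \<Rightarrow>
   (nat \<Rightarrow> 'a) \<Rightarrow> (nat \<Rightarrow> nat \<Rightarrow> nat \<Rightarrow> 'a) \<Rightarrow>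
   (nat \<Rightarrow> nat \<Rightarrow> 'a) \<Rightarrow> (nat \<Rightarrow> nat \<Rightarrow> 'a) \<Rightarrow> bool" where
  "agpdmm K \<eta> \<rho> m f xs x lam_s lam_c \<longleftrightarrow>
     (\<forall>i\<in>{1..m}. lam_s 1 i = 0) \<and>
     (\<forall>r\<ge>1.
        (\<forall>i\<in>{1..m}.
           x r i 0 = xs r \<and>
           (\<forall>k<K. x r i (k + 1) = x r i k -
              (1 / (1 / \<eta> + \<rho>)) *\<^sub>R
                (gradient (f i) (x r i k) + \<rho> *\<^sub>R (x r i k - xs r) + lam_s r i)) \<and>
           lam_c (r + 1) i = \<rho> *\<^sub>R (xs r - x r i K) - lam_s r i) \<and>
        xs (r + 1) = (1 / real m) *\<^sub>R (\<Sum>i=1..m. x r i K - (1 / \<rho>) *\<^sub>R lam_c (r + 1) i) \<and>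
        (\<forall>i\<in>{1..m}.
           lam_s (r + 1) i = \<rho> *\<^sub>R (x r i K - xs (r + 1)) - lam_c (r + 1) i))"

definition gradient_descent :: "real \<Rightarrow> ('a::real_inner \<Rightarrow> real) \<Rightarrow> (nat \<Rightarrow> 'a) \<Rightarrow> bool" where
  "gradient_descent \<eta> F y \<longleftrightarrow> (\<forall>r\<ge>1. y (r + 1) = y r - \<eta> *\<^sub>R gradient F (y r))"

end

theory Submission
  imports Defs
begin

text \<open>The server update makes the multipliers \<open>lam_s\<close> sum to zero over the clients after every
  round (and they vanish initially). With one local step the server average therefore only sees
  the gradients: once through the client iterates and once more through the client multipliers,
  which accounts for the factor 2.\<close>

lemma gradient_eqI:
  assumes "GDERIV f x :> g"
  shows "gradient f x = g"
  unfolding gradient_def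
proof (rule the_equality[where P = "\<lambda>g. GDERIV f x :> g", OF assms])
  fix g' assume "GDERIV f x :> g'"
  then have "(\<lambda>h. inner h g') = (\<lambda>h. inner h g)"
    using assms unfolding gderiv_def by (rule has_derivative_unique)
  then have "\<forall>h. inner h g' = inner h g"
    by (simp add: fun_eq_iff)
  then show "g' = g"
    by (rule vector_eq_ldot[THEN iffD1])
qed

text \<open>Riesz representation in finite dimension: the derivative is a linear functional, and its
  adjoint applied to the real number 1 is the vector representing it.\<close>

lemma GDERIV_gradient:
  fixes f :: "'a::euclidean_space \<Rightarrow> real"
  assumes "f differentiable (at x)"
  shows "GDERIV f x :> gradient f x"
proof -
  obtain f' where f': "(f has_derivative f') (at x)"
    using assms by (auto simp: differentiable_def)
  then have "linear f'"
    by (rule has_derivative_linear)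
  then have "f' = (\<lambda>h. inner h (adjoint f' 1))"
    by (simp add: adjoint_works fun_eq_iff)
  then have "GDERIV f x :> adjoint f' 1"
    using f' by (simp add: gderiv_def)
  then show ?thesis
    by (simp add: gradient_eqI)
qed

text \<open>Linearity of the derivative. It identifies the averaged client gradients with the
  gradient of the averaged objective, as \<open>gradient_descent\<close> requires.\<close>

lemma gradient_cmult_sum:
  fixes f :: "'i \<Rightarrow> 'a::euclidean_space \<Rightarrow> real"
  assumes "\<And>i. i \<in> I \<Longrightarrow> f i differentiable (at x)"
  shows "gradient (\<lambda>y. c * (\<Sum>i\<in>I. f i y)) x = c *\<^sub>R (\<Sum>i\<in>I. gradient (f i) x)"
proof (rule gradient_eqI)
  have "((\<lambda>y. c * (\<Sum>i\<in>I. f i y)) has_derivative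
      (\<lambda>h. c * (\<Sum>i\<in>I. inner h (gradient (f i) x)))) (at x)"
    using GDERIV_gradient[OF assms] unfolding gderiv_def
    by (intro has_derivative_mult_right has_derivative_sum) auto
  then show "GDERIV (\<lambda>y. c * (\<Sum>i\<in>I. f i y)) x :> c *\<^sub>R (\<Sum>i\<in>I. gradient (f i) x)"
    by (simp add: gderiv_def inner_sum_right)
qed

text \<open>For later rounds no induction is involved: the server update, multiplied by
  \<open>\<rho> * real m\<close>, says exactly that the new server multipliers sum to zero.\<close>

lemma agpdmm_sum_lam_s:
  assumes run: "agpdmm K \<eta> \<rho> m f xs x lam_s lam_c"
    and m: "m \<ge> 1" and \<rho>: "\<rho> \<noteq> 0" and r: "r \<ge> 1"
  shows "(\<Sum>i=1..m. lam_s r i) = 0"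
proof (cases "r = 1")
  case True
  then show ?thesis
    using run by (simp add: agpdmm_def)
next
  case False
  \<comment> \<open>The multipliers of round \<open>r\<close> are set at the end of round
    \<open>q\<close>.\<close>
  then obtain q where q: "r = q + 1" "q \<ge> 1"
    using r by (cases r) auto
  let ?X = "\<Sum>i=1..m. x q i K" and ?C = "\<Sum>i=1..m. lam_c (q + 1) i"
  have "xs (q + 1) = (1 / real m) *\<^sub>R (\<Sum>i=1..m. x q i K - (1 / \<rho>) *\<^sub>R lam_c (q + 1) i)"
    using run q by (simp add: agpdmm_def)
  then have "real m *\<^sub>R xs (q + 1) = ?X - (1 / \<rho>) *\<^sub>R ?C"
    using m by (simp add: sum_subtractf flip: scaleR_sum_right)
  then have avg: "\<rho> *\<^sub>R real m *\<^sub>R xs (q + 1) = \<rho> *\<^sub>R ?X - ?C"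
    using \<rho> by (simp add: scaleR_diff_right)
  have "(\<Sum>i=1..m. lam_s r i) = (\<Sum>i=1..m. \<rho> *\<^sub>R (x q i K - xs (q + 1)) - lam_c (q + 1) i)"
    using run q by (intro sum.cong) (auto simp: agpdmm_def)
  also have "\<dots> = \<rho> *\<^sub>R ?X - \<rho> *\<^sub>R real m *\<^sub>R xs (q + 1) - ?C"
    by (simp add: sum_subtractf scaleR_diff_right sum_constant_scaleR flip: scaleR_sum_right)
  finally show ?thesis
    using avg by simp
qed

lemma agpdmm_single_step:
  fixes xs :: "nat \<Rightarrow> 'a::real_inner"
  assumes run: "agpdmm 1 \<eta> \<rho> m f xs x lam_s lam_c"
    and m: "m \<ge> 1" and \<rho>: "\<rho> \<noteq> 0" and r: "r \<ge> 1"
  shows "xs (r + 1) = xs r -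
    (2 / (1 / \<eta> + \<rho>)) *\<^sub>R ((1 / real m) *\<^sub>R (\<Sum>i=1..m. gradient (f i) (xs r)))"
proof -
  define s where "s = 1 / (1 / \<eta> + \<rho>)"
  let ?g = "\<lambda>i. gradient (f i) (xs r)"
  \<comment> \<open>The coefficient of \<open>lam_s r i\<close> does not depend on \<open>i\<close>,
    so this term disappears after summation over the clients.\<close>
  have client: "x r i 1 - (1 / \<rho>) *\<^sub>R lam_c (r + 1) i =
      xs r - (2 * s) *\<^sub>R ?g i - (2 * s - 1 / \<rho>) *\<^sub>R lam_s r i" if i: "i \<in> {1..m}" for i
  proof -
    \<comment> \<open>The local iteration starts at \<open>xs r\<close>, so the proximal term
      vanishes in the first step.\<close>
    have x1: "x r i 1 = xs r - s *\<^sub>R (?g i + lam_s r i)"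
      using run r i by (simp add: agpdmm_def s_def)
    have "lam_c (r + 1) i = \<rho> *\<^sub>R (xs r - x r i 1) - lam_s r i"
      using run r i by (simp add: agpdmm_def)
    then have "(1 / \<rho>) *\<^sub>R lam_c (r + 1) i = s *\<^sub>R (?g i + lam_s r i) - (1 / \<rho>) *\<^sub>R lam_s r i"
      using \<rho> x1 by (simp add: scaleR_diff_right)
    \<comment> \<open>One copy comes from \<open>x r i 1\<close>, the other from the client
      multiplier.\<close>
    moreover have "(2 * s) *\<^sub>R v = s *\<^sub>R v + s *\<^sub>R v" for v :: 'a
      unfolding mult_2 by (rule scaleR_left_distrib)
    ultimately show ?thesis
      unfolding x1 scaleR_left_diff_distrib by (simp add: scaleR_right_distrib)
  qed
  have "xs (r + 1) = (1 / real m) *\<^sub>R (\<Sum>i=1..m. x r i 1 - (1 / \<rho>) *\<^sub>R lam_c (r + 1) i)"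
    using run r by (simp add: agpdmm_def)
  also have "\<dots> = (1 / real m) *\<^sub>R
      (\<Sum>i=1..m. xs r - (2 * s) *\<^sub>R ?g i - (2 * s - 1 / \<rho>) *\<^sub>R lam_s r i)"
    using client by (intro arg_cong[where f = "scaleR _"] sum.cong) auto
  also have "\<dots> = (1 / real m) *\<^sub>R (real m *\<^sub>R xs r - (2 * s) *\<^sub>R (\<Sum>i=1..m. ?g i))"
    using agpdmm_sum_lam_s[OF run m \<rho> r]
    by (simp add: sum_subtractf sum_constant_scaleR flip: scaleR_sum_right)
  also have "\<dots> = xs r - (2 * s) *\<^sub>R ((1 / real m) *\<^sub>R (\<Sum>i=1..m. ?g i))"
    using m by (simp add: scaleR_diff_right)
  finally show ?thesis
    by (simp add: s_def)
qed

theorem mainTheorem4: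
  fixes f :: "nat \<Rightarrow> real ^ 'd \<Rightarrow> real"
    and m :: nat and \<eta> \<rho> :: real
    and xs :: "nat \<Rightarrow> real ^ 'd"
    and x :: "nat \<Rightarrow> nat \<Rightarrow> nat \<Rightarrow> real ^ 'd"
    and lam_s lam_c :: "nat \<Rightarrow> nat \<Rightarrow> real ^ 'd"
  assumes "m \<ge> 1"
    and "\<And>i. i \<in> {1..m} \<Longrightarrow> convex_on UNIV (f i)"
    and "\<And>i. i \<in> {1..m} \<Longrightarrow> continuously_differentiable (f i)"
    and "\<eta> > 0" and "\<rho> > 0"
    and "agpdmm 1 \<eta> \<rho> m f xs x lam_s lam_c"
  shows "(\<forall>r\<ge>1. xs (r + 1) = xs r -
            (2 / (1 / \<eta> + \<rho>)) *\<^sub>R ((1 / real m) *\<^sub>R (\<Sum>i=1..m. gradient (f i) (xs r)))) \<and>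
         (\<rho> = 1 / \<eta> \<longrightarrow>
            (\<forall>r\<ge>1. xs (r + 1) = xs r -
               \<eta> *\<^sub>R ((1 / real m) *\<^sub>R (\<Sum>i=1..m. gradient (f i) (xs r)))) \<and>
            gradient_descent \<eta> (\<lambda>y. (1 / real m) * (\<Sum>i=1..m. f i y)) xs)"
proof -
  have step: "\<forall>r\<ge>1. xs (r + 1) = xs r -
      (2 / (1 / \<eta> + \<rho>)) *\<^sub>R ((1 / real m) *\<^sub>R (\<Sum>i=1..m. gradient (f i) (xs r)))"
    using agpdmm_single_step[OF assms(6,1)] assms(5) by simp
  \<comment> \<open>The denominator becomes \<open>2 / \<eta>\<close>, cancelling the factor
    2.\<close>
  moreover have "2 / (1 / \<eta> + \<rho>) = \<eta>" if "\<rho> = 1 / \<eta>"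
    unfolding that using assms(4) by simp
  moreover have "gradient (\<lambda>y. (1 / real m) * (\<Sum>i=1..m. f i y)) z =
      (1 / real m) *\<^sub>R (\<Sum>i=1..m. gradient (f i) z)" for z
    using assms(3) by (intro gradient_cmult_sum) (auto simp: continuously_differentiable_def)
  ultimately show ?thesis
    unfolding gradient_descent_def by auto
qed

end
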